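(* For any instance of the weighted affine congestion game and any pure Nash equilibrium $x$, there exists a feasible solution of (SDP-CG) with objective value at least $\frac{2}{3+\sqrt5}\,C(x)$.
   Context: Weighted affine congestion game. $N$ is a finite set of players, $E$ a finite set of resources; each player $j\in N$ has a nonempty strategy set $\mathcal S_j\subseteq 2^E$ and weights $w_{ej}\ge 0$ for $e\in E$; each resource $e$ has constants $a_e,b_e\ge 0$. A pure assignment is $x=(x_{ij})_{j\in N,i\in\mathcal S_j}$ with $x_{ij}\in\{0,1\}$ and $\sum_{i\in\mathcal S_j}x_{ij}=1$ for all $j$. The load of $e$ is $\ell_e(x)=\sum_{j\in N}w_{ej}\sum_{i\in\mathcal S_j:\,e\in i}x_{ij}$. The cost of player $j$ is $C_j(x)=\sum_{i\in\mathcal S_j}x_{ij}\sum_{e\in i}w_{ej}\,(a_e\ell_e(x)+b_e)$ and the social cost is $C(x)=\sum_{j\in N}C_j(x)$. A pure assignment $x$ is a pure Nash equilibrium if $C_j(x)\le C_j(x_{-j},i)$ for all $j\in N$, $i\in\mathcal S_j$, where $(x_{-j},i)$ is obtained from $x$ by letting $j$ switch to strategy $i$. (SDP-CG): the variables are reals $y_j$ $(j\in N)$ and vectors $v_0,v_{ij}\in\mathbb R^d$ $(j\in N,i\in\mathcal S_j)$ for some $d\in\mathbb N$, with the standard inner product. Maximize $\sum_{j\in N}y_j-\frac12\|v_0\|^2$ subject to $y_j\le\sum_{e\in i}w_{ej}(a_ew_{ej}+b_e)-\frac12\|v_{ij}\|^2+\langle v_0,v_{ij}\rangle$ for all $j\in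 N$, $i\in\mathcal S_j$; and $\langle v_{ij},v_{i'k}\rangle\le 2\sum_{e\in i\cap i'}a_ew_{ej}w_{ek}$ for all $(i,j)\ne(i',k)$ with $j,k\in N$, $i\in\mathcal S_j$, $i'\in\mathcal S_k$. *)

theory Defs
  imports Complex_Main "Jordan_Normal_Form.Matrix"
begin

text \<open>
  Doubly indexed quantities carry their indices in the order of the mathematical notation:
  \<open>weight G e j\<close> is $w_{ej}$, and \<open>x i j\<close> is $x_{ij}$ for a strategy \<open>i\<close> of player \<open>j\<close>.
\<close>

record ('p, 'e) game =
  players :: "'p set"
  resources :: "'e set"
  strategies :: "'p \<Rightarrow> 'e set set"
  weight :: "'e \<Rightarrow> 'p \<Rightarrow> real"
  slope :: "'e \<Rightarrow> real"
  offset :: "'e \<Rightarrow> real"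

definition weighted_affine_congestion_game :: "('p, 'e) game \<Rightarrow> bool" where
  "weighted_affine_congestion_game G \<longleftrightarrow>
     finite (players G) \<and> finite (resources G) \<and>
     (\<forall>j\<in>players G. strategies G j \<noteq> {} \<and> strategies G j \<subseteq> Pow (resources G)) \<and>
     (\<forall>e\<in>resources G. \<forall>j\<in>players G. 0 \<le> weight G e j) \<and>
     (\<forall>e\<in>resources G. 0 \<le> slope G e \<and> 0 \<le> offset G e)"

text \<open>
  An assignment is a function on all pairs; only its values at \<open>j \<in> players G\<close> and
  \<open>i \<in> strategies G j\<close> are constrained or used.
\<close>

definition pure_assignment :: "('p, 'e) game \<Rightarrow> ('e set \<Rightarrow> 'p \<Rightarrow> real) \<Rightarrow> bool" where
  "pure_assignment G x \<longleftrightarrow>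
     (\<forall>j\<in>players G. (\<forall>i\<in>strategies G j. x i j \<in> {0, 1}) \<and> (\<Sum>i\<in>strategies G j. x i j) = 1)"

definition load :: "('p, 'e) game \<Rightarrow> ('e set \<Rightarrow> 'p \<Rightarrow> real) \<Rightarrow> 'e \<Rightarrow> real" where
  "load G x e = (\<Sum>j\<in>players G. weight G e j * (\<Sum>i\<in>{i \<in> strategies G j. e \<in> i}. x i j))"

definition player_cost :: "('p, 'e) game \<Rightarrow> ('e set \<Rightarrow> 'p \<Rightarrow> real) \<Rightarrow> 'p \<Rightarrow> real" where
  "player_cost G x j =
     (\<Sum>i\<in>strategies G j. x i j * (\<Sum>e\<in>i. weight G e j * (slope G e * load G x e + offset G e)))"

definition social_cost :: "('p, 'e) game \<Rightarrow> ('e set \<Rightarrow> 'p \<Rightarrow> real) \<Rightarrow> real" where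
  "social_cost G x = (\<Sum>j\<in>players G. player_cost G x j)"

text \<open>\<open>deviate x j i\<close> is $(x_{-j}, i)$.\<close>

definition deviate :: "('e set \<Rightarrow> 'p \<Rightarrow> real) \<Rightarrow> 'p \<Rightarrow> 'e set \<Rightarrow> 'e set \<Rightarrow> 'p \<Rightarrow> real" where
  "deviate x j i = (\<lambda>i' k. if k = j then (if i' = i then 1 else 0) else x i' k)"

definition pure_nash :: "('p, 'e) game \<Rightarrow> ('e set \<Rightarrow> 'p \<Rightarrow> real) \<Rightarrow> bool" where
  "pure_nash G x \<longleftrightarrow> pure_assignment G x \<and>
     (\<forall>j\<in>players G. \<forall>i\<in>strategies G j. player_cost G x j \<le> player_cost G (deviate x j i) j)"

text \<open>
  The dimension \<open>d\<close> is itself a variable of (SDP-CG), so vectors of \<open>\<real>\<^sup>d\<close> are elements of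
  \<open>carrier_vec d\<close>; \<open>u \<bullet> u\<close> is the squared Euclidean norm of \<open>u\<close>.
\<close>

definition sdp_cg_feasible ::
  "('p, 'e) game \<Rightarrow> nat \<Rightarrow> ('p \<Rightarrow> real) \<Rightarrow> real vec \<Rightarrow> ('e set \<Rightarrow> 'p \<Rightarrow> real vec) \<Rightarrow> bool" where
  "sdp_cg_feasible G d y v0 v \<longleftrightarrow>
     v0 \<in> carrier_vec d \<and>
     (\<forall>j\<in>players G. \<forall>i\<in>strategies G j. v i j \<in> carrier_vec d) \<and>
     (\<forall>j\<in>players G. \<forall>i\<in>strategies G j.
        y j \<le> (\<Sum>e\<in>i. weight G e j * (slope G e * weight G e j + offset G e))
               - 1 / 2 * (v i j \<bullet> v i j) + v0 \<bullet> v i j) \<and>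
     (\<forall>j\<in>players G. \<forall>k\<in>players G. \<forall>i\<in>strategies G j. \<forall>i'\<in>strategies G k.
        (i, j) \<noteq> (i', k) \<longrightarrow>
        v i j \<bullet> v i' k \<le> 2 * (\<Sum>e\<in>i \<inter> i'. slope G e * weight G e j * weight G e k))"

definition sdp_cg_objective :: "('p, 'e) game \<Rightarrow> ('p \<Rightarrow> real) \<Rightarrow> real vec \<Rightarrow> real" where
  "sdp_cg_objective G y v0 = (\<Sum>j\<in>players G. y j) - 1 / 2 * (v0 \<bullet> v0)"

end

theory Submission
  imports Defs
begin

text \<open>
  Index coordinates by resources and set
  $v_0(e) = \alpha \sqrt{a_e}\, \ell_e(x)$, $v_{ij}(e) = \beta \sqrt{a_e}\, w_{ej}$ for $e \in i$ and
  $v_{ij}(e) = 0$ otherwise, and $y_j = \kappa\, C_j(x)$. The equilibrium condition gives the first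
  family of constraints if $\kappa \le \alpha\beta$ and $\kappa \le 1 - \beta^2/2$, the second one
  holds if $\beta^2 \le 2$, and $\sum_e a_e \ell_e(x)^2 \le C(x)$ gives the objective value
  $(\kappa - \alpha^2/2)\, C(x)$. With $\kappa = \alpha\beta = 1 - \beta^2/2$ this factor is maximal
  at $\beta^2 = 2/\sqrt 5$.
\<close>

text \<open>Vectors of (SDP-CG) are indexed by natural numbers. An enumeration \<open>h\<close> of
  \<open>E\<close> lets functions on \<open>E\<close> be used as vectors, and since it is a
  bijection their scalar product does not depend on the order chosen.\<close>

lemma scalar_prod_vec_bij_betw:
  fixes f g :: "'e \<Rightarrow> 'a::semiring_0"
  assumes "bij_betw h {0..<n} E"
  shows "vec n (\<lambda>m. f (h m)) \<bullet> vec n (\<lambda>m. g (h m)) = (\<Sum>e\<in>E. f e * g e)"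
proof -
  have "vec n (\<lambda>m. f (h m)) \<bullet> vec n (\<lambda>m. g (h m)) = (\<Sum>m\<in>{0..<n}. f (h m) * g (h m))"
    by (simp add: scalar_prod_def)
  also have "\<dots> = (\<Sum>e\<in>E. f e * g e)"
    by (rule sum.reindex_bij_betw[OF assms])
  finally show ?thesis .
qed

section \<open>Loads, costs and unilateral deviations\<close>

context
  fixes G :: "('p, 'e) game"
  assumes game: "weighted_affine_congestion_game G"
begin

lemma finite_players: "finite (players G)"
  and finite_resources: "finite (resources G)"
  and strategy_subset: "j \<in> players G \<Longrightarrow> i \<in> strategies G j \<Longrightarrow> i \<subseteq> resources G"
  and weight_nonneg: "e \<in> resources G \<Longrightarrow> j \<in> players G \<Longrightarrow> 0 \<le> weight G e j"
  and slope_nonneg: "e \<in> resources G \<Longrightarrow> 0 \<le> slope G e"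
  and offset_nonneg: "e \<in> resources G \<Longrightarrow> 0 \<le> offset G e"
  using game by (auto simp: weighted_affine_congestion_game_def)

lemma finite_strategies: "j \<in> players G \<Longrightarrow> finite (strategies G j)"
  using strategy_subset finite_resources by (meson Pow_iff finite_Pow_iff finite_subset subsetI)

text \<open>Gives all strategies the common index set \<open>resources G\<close>, so that sums over
  strategies and over resources can be exchanged and compared with scalar products.\<close>

lemma sum_strategy:
  assumes "j \<in> players G" and "i \<in> strategies G j"
  shows "(\<Sum>e\<in>i. f e) = (\<Sum>e\<in>resources G. if e \<in> i then f e else (0::real))"
proof -
  have "(\<Sum>e\<in>resources G. if e \<in> i then f e else 0) = sum f (resources G \<inter> i)"
    by (simp add: sum.inter_restrict finite_resources)
  also have "resources G \<inter> i = i"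
    using strategy_subset[OF assms] by blast
  finally show ?thesis by simp
qed

lemma load_nonneg:
  assumes "pure_assignment G x" and "e \<in> resources G"
  shows "0 \<le> load G x e"
  unfolding load_def
proof (intro sum_nonneg mult_nonneg_nonneg)
  fix j i assume "j \<in> players G" "i \<in> {i \<in> strategies G j. e \<in> i}"
  then have "x i j \<in> {0, 1}"
    using assms by (simp add: pure_assignment_def)
  then show "0 \<le> x i j" by auto
qed (use assms weight_nonneg in auto)

text \<open>Double counting: exchanging the order of summation collects, for each resource, the
  weights of all players using it, and these add up to its load.\<close>

lemma social_cost_eq_sum_resources:
  "social_cost G x = (\<Sum>e\<in>resources G. load G x e * (slope G e * load G x e + offset G e))"
proof -
  let ?c = "\<lambda>e. slope G e * load G x e + offset G e"
  have player: "player_cost G x j =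
      (\<Sum>e\<in>resources G. weight G e j * (\<Sum>i\<in>{i \<in> strategies G j. e \<in> i}. x i j) * ?c e)"
    if j: "j \<in> players G" for j
  proof -
    have "player_cost G x j =
        (\<Sum>i\<in>strategies G j. \<Sum>e\<in>resources G. if e \<in> i then x i j * (weight G e j * ?c e) else 0)"
      unfolding player_cost_def
      by (intro sum.cong refl) (simp add: sum_strategy[OF j] sum_distrib_left if_distrib cong: if_cong)
    also have "\<dots> =
        (\<Sum>e\<in>resources G. \<Sum>i\<in>strategies G j. if e \<in> i then x i j * (weight G e j * ?c e) else 0)"
      by (rule sum.swap)
    also have "\<dots> =
        (\<Sum>e\<in>resources G. \<Sum>i\<in>{i \<in> strategies G j. e \<in> i}. x i j * (weight G e j * ?c e))"
      by (simp add: sum.inter_filter[OF finite_strategies[OF j]])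
    also have "\<dots> =
        (\<Sum>e\<in>resources G. weight G e j * (\<Sum>i\<in>{i \<in> strategies G j. e \<in> i}. x i j) * ?c e)"
      by (simp add: sum_distrib_left sum_distrib_right mult_ac)
    finally show ?thesis .
  qed
  have "social_cost G x = (\<Sum>j\<in>players G. \<Sum>e\<in>resources G.
      weight G e j * (\<Sum>i\<in>{i \<in> strategies G j. e \<in> i}. x i j) * ?c e)"
    by (simp add: social_cost_def player)
  also have "\<dots> = (\<Sum>e\<in>resources G. load G x e * ?c e)"
    unfolding load_def by (subst sum.swap) (simp add: sum_distrib_right)
  finally show ?thesis .
qed

text \<open>Resource by resource, the difference of the two sides is the nonnegative offset part of
  the cost. The left side is the squared norm of \<open>v0\<close> up to the factor \<alpha>
  squared.\<close>

lemma sum_slope_load_le_social_cost: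
  assumes "pure_assignment G x"
  shows "(\<Sum>e\<in>resources G. slope G e * (load G x e)\<^sup>2) \<le> social_cost G x"
  unfolding social_cost_eq_sum_resources
proof (rule sum_mono)
  fix e assume "e \<in> resources G"
  then have "0 \<le> load G x e * offset G e"
    using load_nonneg[OF assms] offset_nonneg by simp
  then show "slope G e * (load G x e)\<^sup>2 \<le> load G x e * (slope G e * load G x e + offset G e)"
    by (simp add: algebra_simps power2_eq_square)
qed

text \<open>The other players contribute the same load before and after the switch, and
  \<open>j\<close> contributes exactly \<open>weight G e j\<close> afterwards. Equality can fail
  because \<open>j\<close> may already have been using \<open>e\<close>; that old contribution is
  nonnegative and is dropped.\<close>

lemma load_deviate_le:
  assumes x: "pure_assignment G x" and j: "j \<in> players G" and i: "i \<in> strategies G j"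
    and e: "e \<in> i"
  shows "load G (deviate x j i) e \<le> load G x e + weight G e j"
proof -
  let ?S = "\<lambda>z k. weight G e k * (\<Sum>i\<in>{i \<in> strategies G k. e \<in> i}. z i k)"
  have "e \<in> resources G"
    using strategy_subset[OF j i] e by blast
  then have "0 \<le> weight G e j"
    using weight_nonneg j by blast
  moreover have "0 \<le> (\<Sum>i\<in>{i \<in> strategies G j. e \<in> i}. x i j)"
    using x j by (intro sum_nonneg) (force simp: pure_assignment_def)
  ultimately have own: "0 \<le> ?S x j" by simp
  have "?S (deviate x j i) j = weight G e j"
    using i e finite_strategies[OF j] by (simp add: deviate_def sum.delta)
  moreover have "(\<Sum>k\<in>players G - {j}. ?S (deviate x j i) k) = (\<Sum>k\<in>players G - {j}. ?S x k)"
    by (rule sum.cong) (auto simp: deviate_def)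
  ultimately have "load G (deviate x j i) e = weight G e j + (\<Sum>k\<in>players G - {j}. ?S x k)"
    unfolding load_def by (simp add: sum.remove[OF finite_players j])
  moreover have "load G x e = ?S x j + (\<Sum>k\<in>players G - {j}. ?S x k)"
    unfolding load_def by (simp add: sum.remove[OF finite_players j])
  ultimately show ?thesis using own by simp
qed

lemma player_cost_deviate:
  assumes j: "j \<in> players G" and i: "i \<in> strategies G j"
  shows "player_cost G (deviate x j i) j =
    (\<Sum>e\<in>i. weight G e j * (slope G e * load G (deviate x j i) e + offset G e))"
proof -
  let ?c = "\<lambda>i'. \<Sum>e\<in>i'. weight G e j * (slope G e * load G (deviate x j i) e + offset G e)"
  have "player_cost G (deviate x j i) j = (\<Sum>i'\<in>strategies G j. if i' = i then ?c i' else 0)"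
    unfolding player_cost_def by (rule sum.cong) (auto simp: deviate_def)
  then show ?thesis
    using i finite_strategies[OF j] by simp
qed

text \<open>The equilibrium condition enters the argument here. Bounding the load after the switch
  leaves only the load of \<open>x\<close> itself, which is what the coordinates of
  \<open>v0\<close> encode.\<close>

lemma pure_nash_player_cost_le:
  assumes nash: "pure_nash G x" and j: "j \<in> players G" and i: "i \<in> strategies G j"
  shows "player_cost G x j \<le>
    (\<Sum>e\<in>i. weight G e j * (slope G e * (load G x e + weight G e j) + offset G e))"
proof -
  have x: "pure_assignment G x"
    using nash by (simp add: pure_nash_def)
  have "player_cost G x j \<le> player_cost G (deviate x j i) j"
    using nash j i by (simp add: pure_nash_def)
  also have "\<dots> \<le>
      (\<Sum>e\<in>i. weight G e j * (slope G e * (load G x e + weight G e j) + offset G e))"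
    unfolding player_cost_deviate[OF j i]
  proof (rule sum_mono)
    fix e assume e: "e \<in> i"
    then have "e \<in> resources G"
      using strategy_subset[OF j i] by blast
    then show "weight G e j * (slope G e * load G (deviate x j i) e + offset G e)
        \<le> weight G e j * (slope G e * (load G x e + weight G e j) + offset G e)"
      using load_deviate_le[OF x j i e] weight_nonneg[OF _ j] slope_nonneg
      by (intro mult_left_mono add_right_mono) auto
  qed
  finally show ?thesis .
qed

section \<open>Feasible solutions of (SDP-CG) built from an equilibrium, with free
  parameters\<close>

lemma sdp_cg_solution:
  fixes \<alpha> \<beta> \<kappa> :: real
  assumes nash: "pure_nash G x"
    and \<kappa>: "0 \<le> \<kappa>" "\<kappa> \<le> \<alpha> * \<beta>" "\<kappa> \<le> 1 - \<beta>\<^sup>2 / 2"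
  shows "\<exists>d y v0 v. sdp_cg_feasible G d y v0 v \<and>
           sdp_cg_objective G y v0 \<ge> (\<kappa> - \<alpha>\<^sup>2 / 2) * social_cost G x"
proof -
  have x: "pure_assignment G x"
    using nash by (simp add: pure_nash_def)
  obtain h where h: "bij_betw h {0..<card (resources G)} (resources G)"
    using ex_bij_betw_nat_finite[OF finite_resources] by blast
  define d where "d = card (resources G)"
  define V where "V = (\<lambda>f :: 'e \<Rightarrow> real. vec d (\<lambda>m. f (h m)))"
  define v0 where "v0 = V (\<lambda>e. \<alpha> * sqrt (slope G e) * load G x e)"
  define v where
    "v = (\<lambda>i j. V (\<lambda>e. if e \<in> i then \<beta> * sqrt (slope G e) * weight G e j else 0))"
  define y where "y = (\<lambda>j. \<kappa> * player_cost G x j)"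
  have V_prod: "V f \<bullet> V g = (\<Sum>e\<in>resources G. f e * g e)" for f g
    using scalar_prod_vec_bij_betw[OF h] by (simp add: V_def d_def)
  have V_dim: "V f \<in> carrier_vec d" for f
    by (simp add: V_def)
  \<comment> \<open>Every scalar product below pairs two coordinates carrying a factor
    \<open>sqrt (slope G e)\<close>; the two roots multiply to the slope because it is
    nonnegative.\<close>
  have sq: "(c * sqrt (slope G e) * p) * (c' * sqrt (slope G e) * q) = c * c' * (slope G e * p * q)"
    if "e \<in> resources G" for e c c' p q
  proof -
    have "(c * sqrt (slope G e) * p) * (c' * sqrt (slope G e) * q) =
        c * c' * ((sqrt (slope G e) * sqrt (slope G e)) * p * q)"
      by (simp only: mult_ac)
    then show ?thesis using slope_nonneg[OF that] by simp
  qed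
  have v0_v0: "v0 \<bullet> v0 = \<alpha>\<^sup>2 * (\<Sum>e\<in>resources G. slope G e * (load G x e)\<^sup>2)"
    unfolding v0_def V_prod sum_distrib_left
    by (rule sum.cong) (auto simp: power2_eq_square sq)
  have v0_v: "v0 \<bullet> v i j = (\<Sum>e\<in>i. \<alpha> * \<beta> * (slope G e * load G x e * weight G e j))"
    if "j \<in> players G" "i \<in> strategies G j" for i j
    unfolding v0_def v_def V_prod sum_strategy[OF that]
    by (rule sum.cong) (auto simp: sq)
  \<comment> \<open>Each vector is supported on its own strategy, so only the resources in the
    intersection survive. The case of equal index pairs is included and gives the squared
    norm.\<close>
  have v_v: "v i j \<bullet> v i' k = \<beta>\<^sup>2 * (\<Sum>e\<in>i \<inter> i'. slope G e * weight G e j * weight G e k)"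
    if "j \<in> players G" "i \<in> strategies G j" for i j i' k
  proof -
    have "v i j \<bullet> v i' k = (\<Sum>e\<in>resources G. if e \<in> i \<inter> i'
        then \<beta>\<^sup>2 * (slope G e * weight G e j * weight G e k) else 0)"
      unfolding v_def V_prod
      by (rule sum.cong) (auto simp: power2_eq_square sq)
    also have "\<dots> = (\<Sum>e\<in>resources G \<inter> (i \<inter> i'). \<beta>\<^sup>2 * (slope G e * weight G e j * weight G e k))"
      by (simp only: sum.inter_restrict[OF finite_resources])
    also have "resources G \<inter> (i \<inter> i') = i \<inter> i'"
      using strategy_subset[OF that] by blast
    finally show ?thesis by (simp add: sum_distrib_left)
  qed
  \<comment> \<open>Combine the lower and upper bounds on \<kappa>: 0 \<le> \<kappa> \<le> 1 -
    \<beta>*\<beta>/2.\<close>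
  have \<beta>: "\<beta>\<^sup>2 \<le> 2" using \<kappa> by simp
  have "y j \<le> (\<Sum>e\<in>i. weight G e j * (slope G e * weight G e j + offset G e))
               - 1 / 2 * (v i j \<bullet> v i j) + v0 \<bullet> v i j"
    if j: "j \<in> players G" and i: "i \<in> strategies G j" for i j
  proof -
    have "y j \<le> \<kappa> *
        (\<Sum>e\<in>i. weight G e j * (slope G e * (load G x e + weight G e j) + offset G e))"
      unfolding y_def using pure_nash_player_cost_le[OF nash j i] \<kappa>(1) by (rule mult_left_mono)
    \<comment> \<open>Compare three kinds of terms on each resource: offset times weight needs
      \<kappa> \<le> 1, slope times squared weight needs \<kappa> \<le> 1 - \<beta>*\<beta>/2, and
      slope times load times weight needs \<kappa> \<le> \<alpha>*\<beta>.\<close>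
    also have "\<dots> \<le> (\<Sum>e\<in>i. weight G e j * (slope G e * weight G e j + offset G e)
        - \<beta>\<^sup>2 / 2 * (slope G e * weight G e j * weight G e j)
        + \<alpha> * \<beta> * (slope G e * load G x e * weight G e j))"
      unfolding sum_distrib_left
    proof (rule sum_mono)
      fix e assume "e \<in> i"
      then have e: "e \<in> resources G"
        using strategy_subset[OF j i] by blast
      note nonneg = weight_nonneg[OF e j] slope_nonneg[OF e] offset_nonneg[OF e] load_nonneg[OF x e]
      have "\<kappa> \<le> 1" using \<kappa>(3) by (smt (verit) zero_le_power2 divide_nonneg_pos)
      then have "\<kappa> * (offset G e * weight G e j) \<le> 1 * (offset G e * weight G e j)"
        using nonneg by (intro mult_right_mono) auto
      moreover have "\<kappa> * (slope G e * weight G e j * weight G e j)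
          \<le> (1 - \<beta>\<^sup>2 / 2) * (slope G e * weight G e j * weight G e j)"
        using \<kappa>(3) nonneg by (intro mult_right_mono) auto
      moreover have "\<kappa> * (slope G e * load G x e * weight G e j)
          \<le> \<alpha> * \<beta> * (slope G e * load G x e * weight G e j)"
        using \<kappa>(2) nonneg by (intro mult_right_mono) auto
      ultimately show "\<kappa> * (weight G e j * (slope G e * (load G x e + weight G e j) + offset G e))
          \<le> weight G e j * (slope G e * weight G e j + offset G e)
            - \<beta>\<^sup>2 / 2 * (slope G e * weight G e j * weight G e j)
            + \<alpha> * \<beta> * (slope G e * load G x e * weight G e j)"
        by (simp add: algebra_simps)
    qed
    also have "\<dots> = (\<Sum>e\<in>i. weight G e j * (slope G e * weight G e j + offset G e))
               - 1 / 2 * (v i j \<bullet> v i j) + v0 \<bullet> v i j"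
      by (simp add: v_v[OF j i] v0_v[OF j i] sum.distrib sum_subtractf sum_distrib_left)
    finally show ?thesis .
  qed
  moreover have "v i j \<bullet> v i' k \<le> 2 * (\<Sum>e\<in>i \<inter> i'. slope G e * weight G e j * weight G e k)"
    if j: "j \<in> players G" and k: "k \<in> players G" and i: "i \<in> strategies G j" for i j i' k
  proof -
    have "0 \<le> (\<Sum>e\<in>i \<inter> i'. slope G e * weight G e j * weight G e k)"
      using strategy_subset[OF j i] slope_nonneg weight_nonneg j k
      by (intro sum_nonneg mult_nonneg_nonneg) auto
    then show ?thesis
      unfolding v_v[OF j i] using \<beta> by (rule mult_right_mono[rotated])
  qed
  ultimately have "sdp_cg_feasible G d y v0 v"
    unfolding sdp_cg_feasible_def using V_dim by (auto simp: v0_def v_def)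
  \<comment> \<open>The values \<open>y j\<close> sum to \<kappa> times the social cost, so it
    remains to bound half the squared norm of \<open>v0\<close>.\<close>
  moreover have "\<alpha>\<^sup>2 / 2 * (\<Sum>e\<in>resources G. slope G e * (load G x e)\<^sup>2)
      \<le> \<alpha>\<^sup>2 / 2 * social_cost G x"
    by (intro mult_left_mono sum_slope_load_le_social_cost[OF x]) simp
  then have "sdp_cg_objective G y v0 \<ge> (\<kappa> - \<alpha>\<^sup>2 / 2) * social_cost G x"
    unfolding sdp_cg_objective_def v0_v0 y_def sum_distrib_left[symmetric] social_cost_def[symmetric]
    by (simp add: left_diff_distrib)
  ultimately show ?thesis by blast
qed

end

section \<open>Choice of the constants\<close>

theorem theorem5p1:
  fixes G :: "('p, 'e) game" and x :: "'e set \<Rightarrow> 'p \<Rightarrow> real"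
  assumes "weighted_affine_congestion_game G"
    and "pure_nash G x"
  shows "\<exists>d y v0 v. sdp_cg_feasible G d y v0 v \<and>
           sdp_cg_objective G y v0 \<ge> 2 / (3 + sqrt 5) * social_cost G x"
proof -
  define s where "s = sqrt (5::real)"
  define \<beta> where "\<beta> = sqrt (2 / s)"
  \<comment> \<open>This is 1 - \<beta>*\<beta>/2, and \<alpha> is then chosen so that
    \<alpha>*\<beta> = \<kappa>: both upper bounds on \<kappa> are tight.\<close>
  define \<kappa> where "\<kappa> = 1 - 1 / s"
  define \<alpha> where "\<alpha> = \<kappa> / \<beta>"
  have s: "s * s = 5" "1 \<le> s" by (simp_all add: s_def)
  then have \<beta>: "\<beta>\<^sup>2 = 2 / s" "0 < \<beta>" by (simp_all add: \<beta>_def)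
  \<comment> \<open>Since \<open>s * s = 5\<close>, 1/s equals s/5. With \<open>s\<close> out of the
    denominators, the remaining identities are polynomial in \<open>s\<close> modulo this
    relation.\<close>
  have eqs: "\<kappa> = 1 - s / 5" "\<beta>\<^sup>2 = 2 * s / 5"
    unfolding \<kappa>_def \<beta>(1) using s by (simp_all add: field_simps)
  have "\<alpha>\<^sup>2 = (1 - s / 5)\<^sup>2 / (2 * s / 5)"
    by (simp only: \<alpha>_def power_divide eqs)
  also have "\<dots> = (3 * s - 5) / 5"
  proof -
    have "(1 - s / 5)\<^sup>2 = (3 * s - 5) / 5 * (2 * s / 5)"
      using s(1) by (simp add: field_simps power2_eq_square)
    moreover have "2 * s / 5 \<noteq> 0" using s(2) by simp
    ultimately show ?thesis by (metis nonzero_mult_div_cancel_right)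
  qed
  finally have "\<kappa> - \<alpha>\<^sup>2 / 2 = (3 - s) / 2"
    by (simp add: eqs(1) field_simps)
  \<comment> \<open>Rationalising: (3 - s) * (3 + s) = 9 - 5 = 4.\<close>
  also have "\<dots> = 2 / (3 + s)"
    using s by (simp add: field_simps)
  finally have "\<kappa> - \<alpha>\<^sup>2 / 2 = 2 / (3 + s)" .
  moreover have "0 \<le> \<kappa>" "\<kappa> \<le> \<alpha> * \<beta>" "\<kappa> \<le> 1 - \<beta>\<^sup>2 / 2"
    using s \<beta> by (simp_all add: \<kappa>_def \<alpha>_def)
  ultimately show ?thesis
    using sdp_cg_solution[OF assms, of \<kappa> \<alpha> \<beta>] by (simp add: s_def)
qed

end
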